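(* Let $G=(V,E)$ be an infinite, connected, locally finite graph all of whose vertices have even degree, and suppose simple random walk on $G$ is transient. Then for every rule $\mathcal{R}$ and every starting vertex $X_0$, the greedy random walk on $G$ almost surely visits $X_0$ only finitely many times. In particular, for every $d\ge3$ and every rule $\mathcal{R}$, the greedy random walk on $\mathbb{Z}^d$ started at the origin returns to the origin only finitely many times almost surely.
   Context: A greedy random walk (GRW) on a connected locally finite graph $G=(V,E)$ with rule $\mathcal{R}$ started at $v_0$: $X_0=v_0$; with $H_t=\{\{X_{s-1},X_s\}:0<s\le t\}$ (edges traversed up to time $t$) and $J_t(v)=\{e\in E: v\in e, e\notin H_t\}$, if $J_t(X_t)\ne\emptyset$ then $X_{t+1}=w$ for some $w$ with $\{X_t,w\}\in J_t(X_t)$, chosen according to an arbitrary (possibly randomized, history-dependent) rule $\mathcal{R}$; if $J_t(X_t)=\emptyset$ then $X_{t+1}$ is a uniformly random neighbor of $X_t$. $\mathbb{Z}^d$ denotes the nearest-neighbor integer lattice. *)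

theory Defs
  imports "HOL-Probability.Probability"
begin

definition nbrs :: "('v \<Rightarrow> 'v \<Rightarrow> bool) \<Rightarrow> 'v \<Rightarrow> 'v set" where
  "nbrs adj v = {w. adj v w}"

definition deg :: "('v \<Rightarrow> 'v \<Rightarrow> bool) \<Rightarrow> 'v \<Rightarrow> nat" where
  "deg adj v = card (nbrs adj v)"

definition simple_graph :: "'v set \<Rightarrow> ('v \<Rightarrow> 'v \<Rightarrow> bool) \<Rightarrow> bool" where
  "simple_graph V adj \<longleftrightarrow>
     (\<forall>x y. adj x y \<longrightarrow> x \<in> V \<and> y \<in> V) \<and>
     (\<forall>x y. adj x y \<longrightarrow> adj y x) \<and> (\<forall>x. \<not> adj x x)"

definition connected_graph :: "'v set \<Rightarrow> ('v \<Rightarrow> 'v \<Rightarrow> bool) \<Rightarrow> bool" where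
  "connected_graph V adj \<longleftrightarrow> (\<forall>x\<in>V. \<forall>y\<in>V. adj\<^sup>*\<^sup>* x y)"

definition locally_finite :: "'v set \<Rightarrow> ('v \<Rightarrow> 'v \<Rightarrow> bool) \<Rightarrow> bool" where
  "locally_finite V adj \<longleftrightarrow> (\<forall>v\<in>V. finite (nbrs adj v))"

definition all_degrees_even :: "'v set \<Rightarrow> ('v \<Rightarrow> 'v \<Rightarrow> bool) \<Rightarrow> bool" where
  "all_degrees_even V adj \<longleftrightarrow> (\<forall>v\<in>V. even (deg adj v))"

definition first_return_walks :: "('v \<Rightarrow> 'v \<Rightarrow> bool) \<Rightarrow> 'v \<Rightarrow> nat \<Rightarrow> 'v list set" where
  "first_return_walks adj v n =
     {xs. 1 \<le> n \<and> length xs = Suc n \<and> xs ! 0 = v \<and> xs ! n = v \<and>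
          (\<forall>i<n. adj (xs ! i) (xs ! Suc i)) \<and> (\<forall>i. 0 < i \<and> i < n \<longrightarrow> xs ! i \<noteq> v)}"

definition srw_weight :: "('v \<Rightarrow> 'v \<Rightarrow> bool) \<Rightarrow> 'v list \<Rightarrow> real" where
  "srw_weight adj xs = (\<Prod>i<length xs - 1. 1 / real (deg adj (xs ! i)))"

definition srw_first_return :: "('v \<Rightarrow> 'v \<Rightarrow> bool) \<Rightarrow> 'v \<Rightarrow> nat \<Rightarrow> real" where
  "srw_first_return adj v n = (\<Sum>xs\<in>first_return_walks adj v n. srw_weight adj xs)"

definition srw_transient :: "'v set \<Rightarrow> ('v \<Rightarrow> 'v \<Rightarrow> bool) \<Rightarrow> bool" where
  "srw_transient V adj \<longleftrightarrow>
     (\<forall>v\<in>V. summable (srw_first_return adj v) \<and> (\<Sum>n. srw_first_return adj v n) < 1)"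

definition used_edges :: "'v list \<Rightarrow> 'v set set" where
  "used_edges xs = {{xs ! i, xs ! Suc i} | i. Suc i < length xs}"

definition unused_nbrs :: "('v \<Rightarrow> 'v \<Rightarrow> bool) \<Rightarrow> 'v list \<Rightarrow> 'v set" where
  "unused_nbrs adj xs = {w. adj (last xs) w \<and> {last xs, w} \<notin> used_edges xs}"

definition valid_rule :: "('v \<Rightarrow> 'v \<Rightarrow> bool) \<Rightarrow> ('v list \<Rightarrow> 'v pmf) \<Rightarrow> bool" where
  "valid_rule adj R \<longleftrightarrow>
     (\<forall>xs. xs \<noteq> [] \<longrightarrow> unused_nbrs adj xs \<noteq> {} \<longrightarrow> set_pmf (R xs) \<subseteq> unused_nbrs adj xs)"

definition grw_step :: "('v \<Rightarrow> 'v \<Rightarrow> bool) \<Rightarrow> ('v list \<Rightarrow> 'v pmf) \<Rightarrow> 'v list \<Rightarrow> 'v pmf" where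
  "grw_step adj R xs =
     (if unused_nbrs adj xs \<noteq> {} then R xs else pmf_of_set (nbrs adj (last xs)))"

text \<open>X is a greedy random walk on the graph with rule R started at v0, defined on the
probability space M: its finite-dimensional laws are those of the history-dependent
transition kernel grw_step.\<close>
definition grw_process ::
  "'w measure \<Rightarrow> ('v \<Rightarrow> 'v \<Rightarrow> bool) \<Rightarrow> ('v list \<Rightarrow> 'v pmf) \<Rightarrow> 'v \<Rightarrow> (nat \<Rightarrow> 'w \<Rightarrow> 'v) \<Rightarrow> bool"
where
  "grw_process M adj R v0 X \<longleftrightarrow>
     prob_space M \<and>
     (\<forall>t. X t \<in> measurable M (count_space UNIV)) \<and>
     (\<forall>\<omega>\<in>space M. X 0 \<omega> = v0) \<and>
     (\<forall>xs w. xs \<noteq> [] \<longrightarrow>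
        measure M {\<omega>\<in>space M. (\<forall>i<length xs. X i \<omega> = xs ! i) \<and> X (length xs) \<omega> = w}
        = measure M {\<omega>\<in>space M. \<forall>i<length xs. X i \<omega> = xs ! i} * pmf (grw_step adj R xs) w)"

definition zlattice :: "nat \<Rightarrow> (nat \<Rightarrow> int) set" where
  "zlattice d = {x. \<forall>i\<ge>d. x i = 0}"

definition zadj :: "nat \<Rightarrow> (nat \<Rightarrow> int) \<Rightarrow> (nat \<Rightarrow> int) \<Rightarrow> bool" where
  "zadj d x y \<longleftrightarrow> x \<in> zlattice d \<and> y \<in> zlattice d \<and> (\<Sum>i<d. \<bar>x i - y i\<bar>) = 1"

end

theory Submission
  imports Defs
begin

text \<open>Because all degrees are even, an excursion along unused edges can only get stuck at the vertex
where it started, its anchor.  The anchor therefore moves like a simple random walk at the times when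
no unused edge is available, and is frozen otherwise.  So if \<open>G \<ge> 0\<close> satisfies
\<open>G x \<ge> 1[x = v\<^sub>0] + (average of G over the neighbours of x)\<close>, then \<open>G\<close> of the anchor plus the number of
stuck visits to \<open>v\<^sub>0\<close> is a supermartingale, and the expected number of stuck visits is at most \<open>G v\<^sub>0\<close>.
Every other visit to \<open>v\<^sub>0\<close> uses up an edge at \<open>v\<^sub>0\<close>, so there are finitely many of those.

Transience provides \<open>G\<close> as the Green function.  On the lattice, an explicit function of the first three
coordinates serves directly, so that Polya's theorem is not needed.\<close>

section \<open>Histories and anchors\<close>

text \<open>Parity has to be tracked at every vertex, not only at the current one as in
  \<open>unused_nbrs\<close>.\<close>

definition unused_at :: "('v \<Rightarrow> 'v \<Rightarrow> bool) \<Rightarrow> 'v list \<Rightarrow> 'v \<Rightarrow> 'v set" where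
  "unused_at adj xs v = {w. adj v w \<and> {v, w} \<notin> used_edges xs}"

lemma unused_nbrs_eq_unused_at: "unused_nbrs adj xs = unused_at adj xs (last xs)"
  by (simp add: unused_nbrs_def unused_at_def)

lemma used_edges_snoc:
  assumes "xs \<noteq> []"
  shows "used_edges (xs @ [w]) = insert {last xs, w} (used_edges xs)"
proof -
  obtain n where n: "length xs = Suc n"
    using assms by (cases xs) auto
  have "used_edges (xs @ [w]) = (\<lambda>i. {(xs @ [w]) ! i, (xs @ [w]) ! Suc i}) ` {..<Suc n}"
    by (auto simp: used_edges_def n)
  also have "\<dots> = insert {last xs, w} ((\<lambda>i. {xs ! i, xs ! Suc i}) ` {..<n})"
    using assms n by (auto simp: lessThan_Suc nth_append last_conv_nth image_iff)
  also have "(\<lambda>i. {xs ! i, xs ! Suc i}) ` {..<n} = used_edges xs"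
    by (auto simp: used_edges_def n)
  finally show ?thesis .
qed

text \<open>The vertex at which the current greedy excursion began, for a history given with the most
recent vertex first.\<close>
primrec anchor_rev :: "('v \<Rightarrow> 'v \<Rightarrow> bool) \<Rightarrow> 'v list \<Rightarrow> 'v" where
  "anchor_rev adj [] = undefined"
| "anchor_rev adj (w # ys) =
     (if ys = [] \<or> unused_nbrs adj (rev ys) = {} then w else anchor_rev adj ys)"

definition anchor :: "('v \<Rightarrow> 'v \<Rightarrow> bool) \<Rightarrow> 'v list \<Rightarrow> 'v" where
  "anchor adj xs = anchor_rev adj (rev xs)"

lemma anchor_single [simp]: "anchor adj [v] = v"
  by (simp add: anchor_def)

lemma anchor_snoc:
  "xs \<noteq> [] \<Longrightarrow>
   anchor adj (xs @ [w]) = (if unused_nbrs adj xs = {} then w else anchor adj xs)"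
  by (simp add: anchor_def)

text \<open>The histories of \<open>n\<close> steps that have positive probability under the kernel.
  For a valid rule on a locally finite graph they are finitely many, so expectations become finite
  sums.\<close>

fun histories :: "('v \<Rightarrow> 'v \<Rightarrow> bool) \<Rightarrow> ('v list \<Rightarrow> 'v pmf) \<Rightarrow> 'v \<Rightarrow> nat \<Rightarrow> 'v list set" where
  "histories adj R v0 0 = {[v0]}"
| "histories adj R v0 (Suc n) =
     (\<Union>xs\<in>histories adj R v0 n. (\<lambda>w. xs @ [w]) ` set_pmf (grw_step adj R xs))"

lemma length_histories: "xs \<in> histories adj R v0 n \<Longrightarrow> length xs = Suc n"
  by (induction n arbitrary: xs) auto

lemma odd_card_Diff_single:
  "finite A \<Longrightarrow> a \<in> A \<Longrightarrow> odd (card (A - {a})) \<longleftrightarrow> even (card A)"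
  by (metis card_Suc_Diff1 even_Suc)

text \<open>Nonempty neighbourhoods ensure that \<open>pmf_of_set\<close> in \<open>grw_step\<close>
  is the uniform distribution.\<close>

locale even_graph =
  fixes V :: "'v set" and adj :: "'v \<Rightarrow> 'v \<Rightarrow> bool"
  assumes simple: "simple_graph V adj"
    and fin: "locally_finite V adj"
    and even_deg: "all_degrees_even V adj"
    and nbrs_nonempty: "\<And>v. v \<in> V \<Longrightarrow> nbrs adj v \<noteq> {}"
begin

lemma adj_in: "adj x y \<Longrightarrow> x \<in> V \<and> y \<in> V"
  and adj_sym: "adj x y \<Longrightarrow> adj y x"
  and adj_irrefl: "\<not> adj x x"
  using simple unfolding simple_graph_def by blast+

lemma finite_nbrs [simp]: "finite (nbrs adj v)"
proof (cases "v \<in> V")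
  case True
  then show ?thesis using fin by (simp add: locally_finite_def)
next
  case False
  then have "nbrs adj v = {}" using adj_in by (auto simp: nbrs_def)
  then show ?thesis by simp
qed

lemma unused_at_subset: "unused_at adj xs v \<subseteq> nbrs adj v"
  by (auto simp: unused_at_def nbrs_def)

lemma finite_unused_at [simp]: "finite (unused_at adj xs v)"
  using finite_subset[OF unused_at_subset finite_nbrs] .

lemma even_deg': "even (card (nbrs adj v))"
proof (cases "v \<in> V")
  case True
  then show ?thesis using even_deg by (simp add: all_degrees_even_def deg_def)
next
  case False
  then have "nbrs adj v = {}" using adj_in by (auto simp: nbrs_def)
  then show ?thesis by simp
qed

lemma unused_at_snoc:
  assumes "xs \<noteq> []"
  shows "unused_at adj (xs @ [w]) v =
    unused_at adj xs v - (if v = last xs then {w} else if v = w then {last xs} else {})"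
  using assms by (auto simp: unused_at_def used_edges_snoc doubleton_eq_iff)

end

locale greedy_walk = even_graph V adj for V :: "'v set" and adj +
  fixes v0 :: 'v and R :: "'v list \<Rightarrow> 'v pmf"
  assumes v0: "v0 \<in> V" and rule: "valid_rule adj R"
begin

lemma set_grw_step:
  assumes "xs \<noteq> []" "last xs \<in> V"
  shows "set_pmf (grw_step adj R xs) \<subseteq>
    (if unused_nbrs adj xs = {} then nbrs adj (last xs) else unused_nbrs adj xs)"
  using assms rule nbrs_nonempty[of "last xs"]
  by (auto simp: grw_step_def valid_rule_def)

lemma set_grw_step_nbrs:
  assumes "xs \<noteq> []" "last xs \<in> V" "w \<in> set_pmf (grw_step adj R xs)"
  shows "adj (last xs) w"
  using set_grw_step[OF assms(1,2)] assms(3)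
  by (auto simp: unused_nbrs_def nbrs_def split: if_splits)

lemma finite_set_grw_step_if_last_in:
  assumes "xs \<noteq> []" "last xs \<in> V"
  shows "finite (set_pmf (grw_step adj R xs))"
  using set_grw_step_nbrs[OF assms] finite_subset[OF _ finite_nbrs[of "last xs"]]
  by (auto simp: nbrs_def)

text \<open>The graph of unused edges has even degree everywhere while the walk is at its anchor, and
otherwise odd degree exactly at the anchor and at the current vertex.  Hence a greedy excursion
can only get stuck where it started.\<close>
lemma histories_parity:
  assumes "xs \<in> histories adj R v0 n"
  shows "last xs \<in> V"
    and "odd (card (unused_at adj xs v)) \<longleftrightarrow> (v = anchor adj xs) \<noteq> (v = last xs)"
proof -
  have "last xs \<in> V \<and>
    (\<forall>v. odd (card (unused_at adj xs v)) \<longleftrightarrow> (v = anchor adj xs) \<noteq> (v = last xs))"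
    using assms
  proof (induction n arbitrary: xs)
    case 0
    have "unused_at adj [v0] v = nbrs adj v" for v
      by (auto simp: unused_at_def nbrs_def used_edges_def)
    with 0 show ?case using v0 even_deg' by auto
  next
    case (Suc n)
    then obtain ys w where ys: "ys \<in> histories adj R v0 n" and xs: "xs = ys @ [w]"
      and w: "w \<in> set_pmf (grw_step adj R ys)"
      by auto
    have ne: "ys \<noteq> []" using length_histories[OF ys] by auto
    have lV: "last ys \<in> V"
      and par: "\<And>v. odd (card (unused_at adj ys v)) \<longleftrightarrow>
                  (v = anchor adj ys) \<noteq> (v = last ys)"
      using Suc.IH[OF ys] by auto
    have ad: "adj (last ys) w" using set_grw_step_nbrs[OF ne lV w] .
    then have lw: "last ys \<noteq> w" using adj_irrefl by auto
    have "odd (card (unused_at adj xs v)) \<longleftrightarrow> (v = anchor adj xs) \<noteq> (v = last xs)" for v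
    proof (cases "unused_nbrs adj ys = {}")
      case True
      then have e: "unused_at adj ys (last ys) = {}"
        by (simp add: unused_nbrs_eq_unused_at)
      then have "anchor adj ys = last ys" using par[of "last ys"] by auto
      then have "even (card (unused_at adj ys v))" using par[of v] by auto
      moreover have "unused_at adj xs v = unused_at adj ys v"
      proof -
        have "{last ys, w} \<in> used_edges ys"
          using e ad by (auto simp: unused_at_def)
        then have "used_edges xs = used_edges ys"
          unfolding xs using used_edges_snoc[OF ne] by auto
        then show ?thesis by (simp add: unused_at_def)
      qed
      ultimately show ?thesis using True ne by (simp add: xs anchor_snoc)
    next
      \<comment> \<open>A fresh edge flips the parity at its two ends only, and the anchor
        stays.\<close>
      case False
      then have "w \<in> unused_nbrs adj ys" using set_grw_step[OF ne lV] w by auto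
      then have w1: "w \<in> unused_at adj ys (last ys)"
        by (simp add: unused_nbrs_eq_unused_at)
      then have w2: "last ys \<in> unused_at adj ys w"
        using adj_sym by (auto simp: unused_at_def insert_commute)
      have "anchor adj xs = anchor adj ys" "last xs = w"
        using False ne by (simp_all add: xs anchor_snoc)
      moreover have "odd (card (unused_at adj xs v)) \<longleftrightarrow>
         (odd (card (unused_at adj ys v)) \<noteq> (v = last ys \<or> v = w))"
        unfolding xs unused_at_snoc[OF ne]
        using odd_card_Diff_single[OF _ w1] odd_card_Diff_single[OF _ w2] by auto
      ultimately show ?thesis using par[of v] lw by auto
    qed
    moreover have "last xs \<in> V" using ad adj_in by (simp add: xs)
    ultimately show ?case by blast
  qed
  then show "last xs \<in> V"
    and "odd (card (unused_at adj xs v)) \<longleftrightarrow> (v = anchor adj xs) \<noteq> (v = last xs)"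
    by auto
qed

lemma histories_not_Nil: "xs \<in> histories adj R v0 n \<Longrightarrow> xs \<noteq> []"
  using length_histories by fastforce

lemma anchor_eq_last_if_stuck:
  assumes "xs \<in> histories adj R v0 n" "unused_nbrs adj xs = {}"
  shows "anchor adj xs = last xs"
  using histories_parity(2)[OF assms(1), of "last xs"] assms(2)
  by (auto simp: unused_nbrs_eq_unused_at)

lemma finite_set_grw_step:
  "xs \<in> histories adj R v0 n \<Longrightarrow> finite (set_pmf (grw_step adj R xs))"
  using finite_set_grw_step_if_last_in histories_parity(1) histories_not_Nil by metis

lemma finite_histories: "finite (histories adj R v0 n)"
proof (induction n)
  case (Suc n)
  show ?case
    unfolding histories.simps
    by (intro finite_UN_I finite_imageI Suc) (rule finite_set_grw_step)
qed simp

lemma sum_histories_Suc: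
  fixes f :: "'v list \<Rightarrow> real"
  shows "sum f (histories adj R v0 (Suc n)) =
    (\<Sum>xs\<in>histories adj R v0 n. \<Sum>w\<in>set_pmf (grw_step adj R xs). f (xs @ [w]))"
proof -
  have "sum f (histories adj R v0 (Suc n)) =
    (\<Sum>xs\<in>histories adj R v0 n. sum f ((\<lambda>w. xs @ [w]) ` set_pmf (grw_step adj R xs)))"
    unfolding histories.simps
    by (rule sum.UNION_disjoint)
       (auto simp: finite_histories finite_set_grw_step)
  also have "\<dots> = (\<Sum>xs\<in>histories adj R v0 n. \<Sum>w\<in>set_pmf (grw_step adj R xs). f (xs @ [w]))"
    by (intro sum.cong refl) (simp add: sum.reindex inj_on_def)
  finally show ?thesis .
qed

end

section \<open>The process\<close>

locale greedy_process = greedy_walk V adj v0 R + prob_space M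
  for V :: "'v set" and adj v0 and R :: "'v list \<Rightarrow> 'v pmf" and M :: "'w measure" +
  fixes X :: "nat \<Rightarrow> 'w \<Rightarrow> 'v"
  assumes process: "grw_process M adj R v0 X"
begin

section \<open>Cylinder events of the process\<close>

definition hist :: "nat \<Rightarrow> 'w \<Rightarrow> 'v list" where
  "hist n \<omega> = map (\<lambda>i. X i \<omega>) [0..<Suc n]"

lemma length_hist [simp]: "length (hist n \<omega>) = Suc n"
  by (simp add: hist_def)

lemma last_hist [simp]: "last (hist n \<omega>) = X n \<omega>"
  by (simp add: hist_def)

lemma nth_hist: "i \<le> n \<Longrightarrow> hist n \<omega> ! i = X i \<omega>"
  unfolding hist_def by (subst nth_map) (auto simp del: upt_Suc)

lemma hist_Suc: "hist (Suc n) \<omega> = hist n \<omega> @ [X (Suc n) \<omega>]"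
  by (simp add: hist_def)

lemma X_measurable: "X t \<in> measurable M (count_space UNIV)"
  and X_0: "\<omega> \<in> space M \<Longrightarrow> X 0 \<omega> = v0"
  using process unfolding grw_process_def by auto

abbreviation cyl :: "nat \<Rightarrow> 'v list \<Rightarrow> 'w set" where
  "cyl n xs \<equiv> {\<omega>\<in>space M. hist n \<omega> = xs}"

lemma hist_eq_iff: "hist n \<omega> = xs \<longleftrightarrow> length xs = Suc n \<and> (\<forall>i<length xs. X i \<omega> = xs ! i)"
  by (auto simp: list_eq_iff_nth_eq nth_hist)

lemma cyl_sets [measurable]: "cyl n xs \<in> sets M"
proof (cases "length xs = Suc n")
  case True
  have *: "{\<omega>\<in>space M. X i \<omega> = y} \<in> sets M" for i y
  proof -
    have "{\<omega>\<in>space M. X i \<omega> = y} = X i -` {y} \<inter> space M" by auto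
    then show ?thesis using measurable_sets[OF X_measurable, of "{y}" i] by (simp only: sets_count_space) simp
  qed
  have "{\<omega>\<in>space M. \<forall>i\<in>{..<length xs}. X i \<omega> = xs ! i} \<in> sets M"
    by (rule sets.sets_Collect_finite_All') (use True * in auto)
  moreover have "cyl n xs = {\<omega>\<in>space M. \<forall>i\<in>{..<length xs}. X i \<omega> = xs ! i}"
    unfolding hist_eq_iff using True by auto
  ultimately show ?thesis by (simp only:)
next
  case False
  then have "cyl n xs = {}" using length_hist by blast
  then show ?thesis by (simp only: sets.empty_sets)
qed

lemma prob_cyl_snoc:
  assumes "length xs = Suc n"
  shows "prob (cyl (Suc n) (xs @ [w])) = prob (cyl n xs) * pmf (grw_step adj R xs) w"
proof -
  have "xs \<noteq> []" using assms by auto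
  then have "prob {\<omega>\<in>space M. (\<forall>i<length xs. X i \<omega> = xs ! i) \<and> X (length xs) \<omega> = w}
        = prob {\<omega>\<in>space M. \<forall>i<length xs. X i \<omega> = xs ! i} * pmf (grw_step adj R xs) w"
    using process unfolding grw_process_def by blast
  moreover have "hist n \<omega> = xs \<longleftrightarrow> (\<forall>i<length xs. X i \<omega> = xs ! i)" for \<omega>
    using assms by (simp add: hist_eq_iff)
  moreover have "hist (Suc n) \<omega> = xs @ [w] \<longleftrightarrow> hist n \<omega> = xs \<and> X (length xs) \<omega> = w" for \<omega>
    using assms by (simp add: hist_Suc)
  ultimately show ?thesis by simp
qed

lemma prob_hist_in:
  assumes "finite A"
  shows "{\<omega>\<in>space M. hist n \<omega> \<in> A} \<in> sets M"
    and "prob {\<omega>\<in>space M. hist n \<omega> \<in> A} = (\<Sum>xs\<in>A. prob (cyl n xs))"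
proof -
  have eq: "{\<omega>\<in>space M. hist n \<omega> \<in> A} = (\<Union>xs\<in>A. cyl n xs)" by auto
  show "{\<omega>\<in>space M. hist n \<omega> \<in> A} \<in> sets M"
    unfolding eq using assms by (intro sets.finite_UN) auto
  show "prob {\<omega>\<in>space M. hist n \<omega> \<in> A} = (\<Sum>xs\<in>A. prob (cyl n xs))"
    unfolding eq using assms
    by (intro finite_measure_finite_Union) (auto simp: disjoint_family_on_def)
qed

text \<open>The tower property of conditional expectation, as a finite sum over histories.\<close>

lemma sum_prob_cyl_Suc:
  fixes f :: "'v list \<Rightarrow> real"
  shows "(\<Sum>xs\<in>histories adj R v0 (Suc n). prob (cyl (Suc n) xs) * f xs) =
    (\<Sum>xs\<in>histories adj R v0 n. prob (cyl n xs) *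
       (\<Sum>w\<in>set_pmf (grw_step adj R xs). pmf (grw_step adj R xs) w * f (xs @ [w])))"
  unfolding sum_histories_Suc sum_distrib_left
  by (intro sum.cong refl) (simp add: prob_cyl_snoc length_histories)

lemma sum_grw_step:
  assumes "xs \<in> histories adj R v0 n"
  shows "(\<Sum>w\<in>set_pmf (grw_step adj R xs). pmf (grw_step adj R xs) w) = 1"
  using sum_pmf_eq_1[OF finite_set_grw_step[OF assms] order_refl] .

lemma sum_prob_cyl: "(\<Sum>xs\<in>histories adj R v0 n. prob (cyl n xs)) = 1"
proof (induction n)
  case 0
  have "cyl 0 [v0] = space M" by (auto simp: hist_def X_0)
  then show ?case by (simp add: prob_space del: Collect_conj_eq)
next
  case (Suc n)
  have "(\<Sum>xs\<in>histories adj R v0 (Suc n). prob (cyl (Suc n) xs)) =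
    (\<Sum>xs\<in>histories adj R v0 n. prob (cyl n xs) * (\<Sum>w\<in>set_pmf (grw_step adj R xs). pmf (grw_step adj R xs) w))"
    using sum_prob_cyl_Suc[of n "\<lambda>_. 1"] by (simp only: mult_1_right)
  also have "\<dots> = (\<Sum>xs\<in>histories adj R v0 n. prob (cyl n xs))"
    by (intro sum.cong refl) (simp only: sum_grw_step mult_1_right)
  finally show ?case using Suc by (simp only:)
qed

text \<open>\<open>grw_process\<close> prescribes finite-dimensional laws only. At each time the
  cylinders over \<open>histories\<close> have total mass 1, so all other paths lie in a countable
  union of null sets.\<close>

lemma AE_hist: "AE \<omega> in M. \<forall>n. hist n \<omega> \<in> histories adj R v0 n"
proof -
  have "AE \<omega> in M. hist n \<omega> \<in> histories adj R v0 n" for n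
  proof -
    have "prob {\<omega>\<in>space M. hist n \<omega> \<in> histories adj R v0 n} = 1"
      using prob_hist_in(2)[OF finite_histories] sum_prob_cyl by simp
    from AE_prob_1[OF this] show ?thesis by eventually_elim simp
  qed
  then show ?thesis by (simp add: AE_all_countable)
qed

text \<open>Each greedy departure from \<open>v\<close> uses a fresh edge at \<open>v\<close>, so
  the departure times inject into the finite set of neighbours.\<close>

lemma finite_greedy_visits:
  assumes h: "\<And>n. hist n \<omega> \<in> histories adj R v0 n"
  shows "finite {t. X t \<omega> = v \<and> unused_nbrs adj (hist t \<omega>) \<noteq> {}}" (is "finite ?C")
proof -
  have step: "X (Suc t) \<omega> \<in> unused_nbrs adj (hist t \<omega>)" if "t \<in> ?C" for t
  proof -
    have "X (Suc t) \<omega> \<in> set_pmf (grw_step adj R (hist t \<omega>))"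
      using h[of "Suc t"] by (auto simp: hist_Suc)
    then show ?thesis
      using set_grw_step[OF histories_not_Nil[OF h] histories_parity(1)[OF h], of t] that by auto
  qed
  have ne: False if "s \<in> ?C" "t \<in> ?C" "s < t" and eq: "X (Suc s) \<omega> = X (Suc t) \<omega>" for s t
  proof -
    have "{hist t \<omega> ! s, hist t \<omega> ! Suc s} \<in> used_edges (hist t \<omega>)"
      using that unfolding used_edges_def by auto
    then show False
      using that eq step[OF that(2)] by (simp add: nth_hist unused_nbrs_def)
  qed
  have "inj_on (\<lambda>t. X (Suc t) \<omega>) ?C"
  proof (rule inj_onI)
    fix s t assume "s \<in> ?C" "t \<in> ?C" and eq: "X (Suc s) \<omega> = X (Suc t) \<omega>"
    then have "\<not> s < t" "\<not> t < s" using ne[of s t] ne[of t s, OF _ _ _ eq[symmetric]] eq by blast+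
    then show "s = t" by simp
  qed
  moreover have "(\<lambda>t. X (Suc t) \<omega>) ` ?C \<subseteq> nbrs adj v"
    using step by (auto simp: unused_nbrs_def nbrs_def)
  ultimately show ?thesis
    using finite_nbrs finite_imageD finite_subset by blast
qed

definition stuck :: "nat \<Rightarrow> 'v list set" where
  "stuck n = {xs \<in> histories adj R v0 n. unused_nbrs adj xs = {} \<and> last xs = v0}"

text \<open>The number of stuck visits to \<^term>\<open>v0\<close> so far plus the potential \<^term>\<open>G\<close> at the anchor is a
supermartingale, so the expected number of stuck visits is at most \<^term>\<open>G v0\<close>.\<close>
lemma AE_finite_visits:
  fixes G :: "'v \<Rightarrow> real"
  assumes G_nonneg: "\<And>x. 0 \<le> G x"
    and G_super: "\<And>x. x \<in> V \<Longrightarrow>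
      (\<Sum>w\<in>nbrs adj x. G w) / deg adj x + of_bool (x = v0) \<le> G x"
  shows "AE \<omega> in M. finite {t. X t \<omega> = v0}"
proof -
  define S where "S n = (\<Sum>xs\<in>histories adj R v0 n. prob (cyl n xs) * G (anchor adj xs))" for n
  define T where "T n = prob {\<omega>\<in>space M. hist n \<omega> \<in> stuck n}" for n
  have fin_stuck: "finite (stuck n)" for n
    unfolding stuck_def using finite_histories by simp
  have T_eq: "T n = (\<Sum>xs\<in>histories adj R v0 n. prob (cyl n xs) * of_bool (xs \<in> stuck n))" for n
  proof -
    have "T n = (\<Sum>xs\<in>stuck n. prob (cyl n xs))"
      unfolding T_def using prob_hist_in(2)[OF fin_stuck] .
    also have "\<dots> = (\<Sum>xs\<in>histories adj R v0 n. prob (cyl n xs) * of_bool (xs \<in> stuck n))"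
      by (rule sum.mono_neutral_cong_left) (auto simp: finite_histories stuck_def)
    finally show ?thesis .
  qed
  have step: "(\<Sum>w\<in>set_pmf (grw_step adj R xs).
        pmf (grw_step adj R xs) w * G (anchor adj (xs @ [w]))) + of_bool (xs \<in> stuck n)
      \<le> G (anchor adj xs)" (is "?L + _ \<le> _")
    if xs: "xs \<in> histories adj R v0 n" for xs n
  proof (cases "unused_nbrs adj xs = {}")
    case True
    have ne: "nbrs adj (last xs) \<noteq> {}"
      using nbrs_nonempty histories_parity(1)[OF xs] .
    \<comment> \<open>The anchor is the current vertex and moves to a uniform neighbour, so
      \<open>G_super\<close> applies there.\<close>
    have "?L = (\<Sum>w\<in>nbrs adj (last xs). G w) / deg adj (last xs)"
      using True ne histories_not_Nil[OF xs]
      by (simp add: grw_step_def anchor_snoc deg_def sum_divide_distrib)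
    moreover have "xs \<in> stuck n \<longleftrightarrow> last xs = v0"
      using True xs by (simp add: stuck_def)
    ultimately show ?thesis
      using G_super[OF histories_parity(1)[OF xs]] anchor_eq_last_if_stuck[OF xs True] by simp
  next
    case False
    \<comment> \<open>The anchor stays whatever the rule chooses, so averaging changes
      nothing.\<close>
    then have "?L = G (anchor adj xs)"
      using sum_grw_step[OF xs] histories_not_Nil[OF xs]
      by (simp add: anchor_snoc flip: sum_distrib_right)
    then show ?thesis using False by (simp add: stuck_def)
  qed
  have ST: "S (Suc n) + T n \<le> S n" for n
    unfolding S_def T_eq sum_prob_cyl_Suc sum.distrib[symmetric] distrib_left[symmetric]
    by (intro sum_mono mult_left_mono step) auto
  have S_nonneg: "0 \<le> S n" for n
    unfolding S_def by (intro sum_nonneg mult_nonneg_nonneg G_nonneg) auto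
  have tele: "(\<Sum>k<n. T k) + S n \<le> S 0" for n
  proof (induction n)
    case (Suc n)
    then show ?case using ST[of n] by simp
  qed simp
  \<comment> \<open>Telescoping bounds the partial sums by \<open>S 0\<close>, which makes
    Borel-Cantelli applicable to the stuck visits.\<close>
  have "summable T"
  proof (rule bounded_imp_summable)
    show "0 \<le> T n" for n by (simp add: T_def)
    show "(\<Sum>k\<le>n. T k) \<le> S 0" for n
      using tele[of "Suc n"] S_nonneg[of "Suc n"] unfolding lessThan_Suc_atMost by linarith
  qed
  then have "AE \<omega> in M. eventually (\<lambda>n. \<omega> \<in> space M - {\<omega>\<in>space M. hist n \<omega> \<in> stuck n}) sequentially"
    using prob_hist_in(1)[OF fin_stuck] unfolding T_def
    by (intro borel_cantelli_AE1) (auto simp: emeasure_eq_measure)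
  with AE_hist show ?thesis
  proof eventually_elim
    case (elim \<omega>)
    have "finite {n. hist n \<omega> \<in> stuck n}"
    proof -
      obtain N where N: "\<And>n. N \<le> n \<Longrightarrow> \<omega> \<in> space M - {\<omega>\<in>space M. hist n \<omega> \<in> stuck n}"
        using elim(2) unfolding eventually_sequentially by blast
      have "{n. hist n \<omega> \<in> stuck n} \<subseteq> {..<N}"
      proof
        fix n assume "n \<in> {n. hist n \<omega> \<in> stuck n}"
        then have "\<not> N \<le> n" using N[of n] by auto
        then show "n \<in> {..<N}" by simp
      qed
      then show ?thesis by (rule finite_subset) simp
    qed
    moreover have "finite {t. X t \<omega> = v0 \<and> unused_nbrs adj (hist t \<omega>) \<noteq> {}}"
      using finite_greedy_visits elim(1) by blast
    moreover have "{t. X t \<omega> = v0} \<subseteq> {n. hist n \<omega> \<in> stuck n} \<union>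
        {t. X t \<omega> = v0 \<and> unused_nbrs adj (hist t \<omega>) \<noteq> {}}"
      using elim(1) by (auto simp: stuck_def)
    ultimately show ?case by (meson finite_UnI finite_subset)
  qed
qed

end

section \<open>Hitting probabilities of transient walks\<close>

text \<open>On a locally finite graph, the probability that simple random walk from \<open>x\<close>
  hits \<open>v\<close> within \<open>n\<close> steps, time 0 included.\<close>

primrec hit_within :: "('v \<Rightarrow> 'v \<Rightarrow> bool) \<Rightarrow> 'v \<Rightarrow> nat \<Rightarrow> 'v \<Rightarrow> real" where
  "hit_within adj v 0 x = of_bool (x = v)"
| "hit_within adj v (Suc n) x =
     (if x = v then 1 else (\<Sum>w\<in>nbrs adj x. hit_within adj v n w) / deg adj x)"

definition first_hit_walks :: "('v \<Rightarrow> 'v \<Rightarrow> bool) \<Rightarrow> 'v \<Rightarrow> nat \<Rightarrow> 'v \<Rightarrow> 'v list set" where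
  "first_hit_walks adj v n x =
     {xs. length xs = Suc n \<and> xs ! 0 = x \<and> xs ! n = v \<and>
          (\<forall>i<n. adj (xs ! i) (xs ! Suc i)) \<and> (\<forall>i<n. xs ! i \<noteq> v)}"

text \<open>The right-hand side allows \<open>v\<close> at index 0, so it covers both first-hit
  walks from \<open>x \<noteq> v\<close> and first-return walks at \<open>x = v\<close>.\<close>

lemma Cons_first_hit_walks:
  "(\<Union>w\<in>nbrs adj x. (#) x ` first_hit_walks adj v n w) =
     {xs. length xs = Suc (Suc n) \<and> xs ! 0 = x \<and> xs ! Suc n = v \<and>
          (\<forall>i<Suc n. adj (xs ! i) (xs ! Suc i)) \<and> (\<forall>i. 0 < i \<and> i < Suc n \<longrightarrow> xs ! i \<noteq> v)}"
  (is "?A = ?B")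
proof (intro equalityI subsetI)
  fix xs assume "xs \<in> ?A"
  then show "xs \<in> ?B"
    by (auto simp: first_hit_walks_def nbrs_def nth_Cons split: nat.splits)
next
  fix xs assume xs: "xs \<in> ?B"
  then obtain ys where ys: "xs = x # ys"
    by (cases xs) auto
  have a: "adj (xs ! i) (xs ! Suc i)" if "i < Suc n" for i using xs that by auto
  have b: "xs ! i \<noteq> v" if "0 < i" "i < Suc n" for i using xs that by auto
  have "ys \<in> first_hit_walks adj v n (ys ! 0)"
    using xs a[of "Suc _"] b[of "Suc _"] by (auto simp: first_hit_walks_def ys)
  moreover have "ys ! 0 \<in> nbrs adj x"
    using a[of 0] by (auto simp: nbrs_def ys)
  ultimately show "xs \<in> ?A" by (auto simp: ys)
qed

lemma first_hit_walks_0: "first_hit_walks adj v 0 x = (if x = v then {[v]} else {})"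
  by (auto simp: first_hit_walks_def length_Suc_conv)

lemma first_hit_walks_Suc:
  "first_hit_walks adj v (Suc n) x =
     (if x = v then {} else \<Union>w\<in>nbrs adj x. (#) x ` first_hit_walks adj v n w)"
  unfolding Cons_first_hit_walks by (auto simp: first_hit_walks_def) (metis gr0I)

lemma first_return_walks_Suc:
  "first_return_walks adj v (Suc n) = (\<Union>w\<in>nbrs adj v. (#) v ` first_hit_walks adj v n w)"
  unfolding Cons_first_hit_walks by (auto simp: first_return_walks_def)

lemma finite_first_hit_walks:
  assumes "\<And>x. finite (nbrs adj x)"
  shows "finite (first_hit_walks adj v n x)"
  by (induction n arbitrary: x) (auto simp: first_hit_walks_0 first_hit_walks_Suc assms)

lemma srw_weight_Cons:
  assumes "ys \<noteq> []"
  shows "srw_weight adj (x # ys) = srw_weight adj ys / deg adj x"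
proof -
  obtain m where m: "length ys = Suc m" using assms by (cases ys) auto
  show ?thesis by (simp add: srw_weight_def m prod.lessThan_Suc_shift del: prod.lessThan_Suc)
qed

text \<open>First-step decomposition: different neighbours give disjoint families of walks, and the
  first step contributes the factor \<open>1 / deg adj x\<close>.\<close>

lemma sum_srw_weight_Cons:
  assumes "\<And>x. finite (nbrs adj x)"
  shows "(\<Sum>xs\<in>(\<Union>w\<in>nbrs adj x. (#) x ` first_hit_walks adj v n w). srw_weight adj xs) =
    (\<Sum>w\<in>nbrs adj x. \<Sum>xs\<in>first_hit_walks adj v n w. srw_weight adj xs) / deg adj x"
proof -
  have "(\<Sum>xs\<in>(\<Union>w\<in>nbrs adj x. (#) x ` first_hit_walks adj v n w). srw_weight adj xs) =
    (\<Sum>w\<in>nbrs adj x. \<Sum>xs\<in>(#) x ` first_hit_walks adj v n w. srw_weight adj xs)"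
    by (rule sum.UNION_disjoint)
       (auto simp: assms finite_first_hit_walks, auto simp: first_hit_walks_def)
  also have "\<dots> = (\<Sum>w\<in>nbrs adj x. \<Sum>xs\<in>first_hit_walks adj v n w. srw_weight adj (x # xs))"
    by (simp add: sum.reindex)
  also have "\<dots> = (\<Sum>w\<in>nbrs adj x. \<Sum>xs\<in>first_hit_walks adj v n w. srw_weight adj xs / deg adj x)"
    by (intro sum.cong refl srw_weight_Cons) (auto simp: first_hit_walks_def)
  finally show ?thesis by (simp add: sum_divide_distrib)
qed

text \<open>Splits according to the exact hitting time \<open>k\<close>; the induction removes the
  first step on both sides.\<close>

lemma hit_within_eq_sum:
  assumes "\<And>x. finite (nbrs adj x)"
  shows "hit_within adj v n x =
    (\<Sum>k\<le>n. \<Sum>xs\<in>first_hit_walks adj v k x. srw_weight adj xs)"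
proof (induction n arbitrary: x)
  case 0
  then show ?case by (simp add: first_hit_walks_0 srw_weight_def)
next
  case (Suc n)
  show ?case
  proof (cases "x = v")
    case True
    then show ?thesis
      by (simp add: sum.atMost_Suc_shift first_hit_walks_0 first_hit_walks_Suc srw_weight_def
          del: sum.atMost_Suc)
  next
    case False
    then show ?thesis
      by (simp add: sum.atMost_Suc_shift first_hit_walks_0 first_hit_walks_Suc Suc.IH
          sum_srw_weight_Cons[OF assms] sum_divide_distrib del: sum.atMost_Suc)
         (rule sum.swap)
  qed
qed

text \<open>A first return is one step to a neighbour followed by a first hit of \<open>v\<close>.
  This links the walk sums in \<open>srw_transient\<close> to hitting probabilities.\<close>

lemma sum_srw_first_return:
  assumes "\<And>x. finite (nbrs adj x)"
  shows "(\<Sum>k\<le>Suc n. srw_first_return adj v k) =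
    (\<Sum>w\<in>nbrs adj v. hit_within adj v n w) / deg adj v"
proof -
  have "srw_first_return adj v 0 = 0"
    by (simp add: srw_first_return_def first_return_walks_def)
  then show ?thesis
    by (simp add: sum.atMost_Suc_shift srw_first_return_def first_return_walks_Suc
        sum_srw_weight_Cons[OF assms] hit_within_eq_sum[OF assms] sum_divide_distrib
        del: sum.atMost_Suc)
       (rule sum.swap)
qed

section \<open>Monotone limits of hitting probabilities\<close>

lemma hit_within_nonneg: "0 \<le> hit_within adj v n x"
  by (induction n arbitrary: x) (auto intro!: divide_nonneg_nonneg sum_nonneg)

lemma hit_within_le_1: "hit_within adj v n x \<le> 1"
proof (induction n arbitrary: x)
  case (Suc n)
  have "(\<Sum>w\<in>nbrs adj x. hit_within adj v n w) \<le> deg adj x"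
    using sum_bounded_above[of "nbrs adj x" "hit_within adj v n" 1] Suc by (simp add: deg_def)
  then show ?case by (auto simp: divide_le_eq_1)
qed simp

lemma hit_within_mono: "hit_within adj v n x \<le> hit_within adj v (Suc n) x"
proof (induction n arbitrary: x)
  case 0
  then show ?case by (auto intro!: divide_nonneg_nonneg sum_nonneg)
next
  case (Suc n)
  then show ?case
    by (subst (1 2) hit_within.simps) (auto intro!: divide_right_mono sum_mono simp del: hit_within.simps)
qed

text \<open>The potential is the probability of ever hitting \<^term>\<open>v\<close>, divided by the escape probability
from \<^term>\<open>v\<close>, i.e. the Green function.\<close>
lemma transient_imp_potential:
  assumes fin: "\<And>x. finite (nbrs adj x)"
    and summable: "summable (srw_first_return adj v)"
    and less: "(\<Sum>n. srw_first_return adj v n) < 1"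
  obtains G :: "'v \<Rightarrow> real" where "\<And>x. 0 \<le> G x"
    "\<And>x. (\<Sum>w\<in>nbrs adj x. G w) / deg adj x + of_bool (x = v) \<le> G x"
proof -
  define F where "F = (\<Sum>n. srw_first_return adj v n)"
  have F: "F < 1" using less by (simp add: F_def)
  define h where "h x = lim (\<lambda>n. hit_within adj v n x)" for x
  have lim: "(\<lambda>n. hit_within adj v n x) \<longlonglongrightarrow> h x" for x
  proof -
    have "incseq (\<lambda>n. hit_within adj v n x)"
      using hit_within_mono by (rule incseq_SucI)
    then have "convergent (\<lambda>n. hit_within adj v n x)"
      by (intro Bseq_monoseq_convergent BseqI'[of _ 1] incseq_imp_monoseq)
         (auto simp: abs_of_nonneg hit_within_nonneg hit_within_le_1)
    then show ?thesis unfolding h_def by (simp add: convergent_LIMSEQ_iff)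
  qed
  have avg: "(\<lambda>n. (\<Sum>w\<in>nbrs adj x. hit_within adj v n w) / deg adj x)
      \<longlonglongrightarrow> (\<Sum>w\<in>nbrs adj x. h w) / deg adj x" for x
    unfolding divide_inverse by (intro tendsto_mult_right tendsto_sum lim)
  have h0: "0 \<le> h x" for x
    using lim by (rule LIMSEQ_le_const) (auto simp: hit_within_nonneg)
  have hv: "h v = 1"
  proof -
    have "hit_within adj v n v = 1" for n by (cases n) auto
    then show ?thesis using lim[of v] by (simp add: LIMSEQ_const_iff)
  qed
  \<comment> \<open>Passing to the limit in the recursion makes \<open>h\<close> harmonic away from
    \<open>v\<close>.\<close>
  have off: "(\<Sum>w\<in>nbrs adj x. h w) / deg adj x = h x" if "x \<noteq> v" for x
    using LIMSEQ_unique[OF avg, of x "h x"] LIMSEQ_Suc[OF lim, of x] that by simp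
  \<comment> \<open>Since \<open>h v = 1\<close>, the deficit of \<open>h\<close> at
    \<open>v\<close> is the escape probability \<open>1 - F\<close>; dividing by it makes the
    deficit 1.\<close>
  have at: "(\<Sum>w\<in>nbrs adj v. h w) / deg adj v = F"
  proof -
    have "(\<lambda>n. \<Sum>k\<le>Suc n. srw_first_return adj v k) \<longlonglongrightarrow> F"
      unfolding F_def by (intro LIMSEQ_Suc summable_LIMSEQ' summable)
    then show ?thesis
      unfolding sum_srw_first_return[OF fin] using LIMSEQ_unique avg by blast
  qed
  show thesis
  proof
    show "0 \<le> h x / (1 - F)" for x using h0 F by simp
    show "(\<Sum>w\<in>nbrs adj x. h w / (1 - F)) / deg adj x + of_bool (x = v) \<le> h x / (1 - F)" for x
    proof -
      have "(\<Sum>w\<in>nbrs adj x. h w / (1 - F)) / deg adj x =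
          (\<Sum>w\<in>nbrs adj x. h w) / deg adj x / (1 - F)"
        by (simp add: sum_divide_distrib mult.commute)
      also have "\<dots> + of_bool (x = v) \<le> h x / (1 - F)"
      proof (cases "x = v")
        case True
        then show ?thesis using F by (simp only: at hv) (simp add: field_simps)
      next
        case False
        then show ?thesis by (simp only: off[OF False]) simp
      qed
      finally show ?thesis .
    qed
  qed
qed

section \<open>A superharmonic function on the lattice\<close>

text \<open>A root-free form of a quadratic upper bound for \<open>(1 + u) powr (-1/4)\<close>. The
  coefficient 3/16 exceeds the Taylor coefficient 5/32, which leaves room near 0.\<close>

lemma one_plus_mult_quartic_ge_1:
  fixes u :: real
  assumes "-1/8 \<le> u"
  shows "1 \<le> (1 + u) * (1 - u / 4 + 3 / 16 * u\<^sup>2) ^ 4"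
proof -
  \<comment> \<open>The quadratic matches the Taylor polynomial to first order, so the excess over 1
    is divisible by \<open>u\<^sup>2\<close>; \<open>q\<close> is the quotient.\<close>
  define q where "q = 1/8 + u/2 - 69/256*u^2 + 61/256*u^3 - 159/2048*u^4 + 135/4096*u^5
    - 351/65536*u^6 + 81/65536*u^7"
  have eq: "(1 + u) * (1 - u / 4 + 3 / 16 * u\<^sup>2) ^ 4 = 1 + u\<^sup>2 * q"
    unfolding q_def by (simp add: power2_eq_square power4_eq_xxxx eval_nat_numeral field_simps)
  have "0 \<le> q"
  proof (cases "0 \<le> u")
    case True
    \<comment> \<open>The negative terms of \<open>q\<close> have degrees 2, 4 and 6. Splitting the
      coefficients of degrees 3 and 5 between adjacent groups puts each negative term into a
      quadratic that completing the square shows positive.\<close>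
    have a: "0 \<le> 1/2 - 69/256*u + 45/256*u^2"
    proof -
      have "1/2 - 69/256*u + 45/256*u^2 = 45/256 * (u - 23/30)^2 + 2031/5120"
        by (simp add: power2_eq_square field_simps)
      then show ?thesis by simp
    qed
    have b: "0 \<le> 16/256 - 159/2048*u + 27/1024*u^2"
    proof -
      have "16/256 - 159/2048*u + 27/1024*u^2 = 27/1024 * (u - 53/36)^2 + 263/49152"
        by (simp add: power2_eq_square field_simps)
      then show ?thesis by simp
    qed
    have c: "0 \<le> 27/4096 - 351/65536*u + 81/65536*u^2"
    proof -
      have "27/4096 - 351/65536*u + 81/65536*u^2 = 81/65536 * (u - 13/6)^2 + 207/262144"
        by (simp add: power2_eq_square field_simps)
      then show ?thesis by simp
    qed
    have "q = 1/8 + u * (1/2 - 69/256*u + 45/256*u^2) + u^3 * (16/256 - 159/2048*u + 27/1024*u^2)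
        + u^5 * (27/4096 - 351/65536*u + 81/65536*u^2)"
      unfolding q_def by (simp add: eval_nat_numeral field_simps)
    then show ?thesis using True a b c by simp
  next
    case False
    define v where "v = - u"
    have v: "0 \<le> v" "v \<le> 1/8" using False assms by (auto simp: v_def)
    \<comment> \<open>Here all nonconstant terms are nonpositive, and these crude bounds keep their
      total below 1/8.\<close>
    have p: "v ^ n \<le> 1/64" if "2 \<le> n" for n
    proof -
      have "v ^ n \<le> v ^ 2" using v that by (intro power_decreasing) auto
      also have "\<dots> \<le> (1/8) ^ 2" using v by (intro power_mono)
      finally show ?thesis by (simp add: power2_eq_square)
    qed
    have "q = 1/8 - v/2 - 69/256 * v^2 - 61/256 * v^3 - 159/2048 * v^4 - 135/4096 * v^5
      - 351/65536 * v^6 - 81/65536 * v^7"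
      by (simp add: q_def v_def)
    also have "0 \<le> \<dots>"
      using p[of 2] p[of 3] p[of 4] p[of 5] p[of 6] p[of 7] v by simp
    finally show ?thesis .
  qed
  then show ?thesis unfolding eq by simp
qed

text \<open>Scaling by \<open>s\<close> reduces this to the quartic inequality at
  \<open>u = d / s\<close>, after taking fourth roots.\<close>

lemma powr_minus_quarter_le:
  fixes s d :: real
  assumes s: "0 < s" and d: "- s / 8 \<le> d"
  shows "(s + d) powr (-1/4) \<le> s powr (-1/4) * (1 - d / s / 4 + 3 / 16 * (d / s)\<^sup>2)"
proof -
  define u where "u = d / s"
  define m where "m = 1 - u / 4 + 3 / 16 * u\<^sup>2"
  have u: "-1/8 \<le> u" using s d by (simp add: u_def field_simps)
  have "m = 11/12 + 3/16 * (u - 2/3)\<^sup>2"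
    by (simp add: m_def power2_eq_square algebra_simps)
  then have m: "0 < m" by (smt (verit) zero_le_power2 mult_nonneg_nonneg divide_pos_pos)
  have "1 / (1 + u) \<le> m ^ 4"
    using one_plus_mult_quartic_ge_1[OF u] u by (simp add: m_def field_simps)
  then have "(1 / (1 + u)) powr (1/4) \<le> (m ^ 4) powr (1/4)"
    using u by (intro powr_mono2) auto
  also have "(m ^ 4) powr (1/4) = m"
    using m by (simp add: powr_powr flip: powr_numeral)
  also have "(1 / (1 + u)) powr (1/4) = (1 + u) powr (-1/4)"
    using u by (simp add: powr_minus_divide powr_divide)
  finally have le: "(1 + u) powr (-1/4) \<le> m" .
  have "s + d = s * (1 + u)" using s by (simp add: u_def field_simps)
  then have "(s + d) powr (-1/4) = s powr (-1/4) * (1 + u) powr (-1/4)"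
    using s u by (simp add: powr_mult)
  also have "\<dots> \<le> s powr (-1/4) * m"
    using le by (intro mult_left_mono) auto
  finally show ?thesis by (simp add: m_def u_def)
qed

text \<open>In dimension 3 the continuous function \<open>(64 + |x|\<^sup>2)\<^sup>-\<^sup>1\<^sup>/\<^sup>4\<close> is strictly superharmonic; the shift
by 64 is large enough to absorb the discretisation error.\<close>
lemma lattice_potential_3:
  fixes x y z :: real
  defines "g \<equiv> \<lambda>x y z. (64 + x\<^sup>2 + y\<^sup>2 + z\<^sup>2 :: real) powr (-1/4)"
  shows "g (x + 1) y z + g (x - 1) y z + (g x (y + 1) z + g x (y - 1) z) +
    (g x y (z + 1) + g x y (z - 1)) < 6 * g x y z"
proof -
  define s where "s = 64 + x\<^sup>2 + y\<^sup>2 + z\<^sup>2"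
  define p where "p = s powr (-1/4)"
  have s: "64 \<le> s" by (simp add: s_def)
  then have p: "0 < p" by (simp add: p_def)
  \<comment> \<open>Opposite neighbours change \<open>s\<close> by \<open>1 + 2 * a\<close> and
    \<open>1 - 2 * a\<close>; in the sum the terms linear in \<open>a\<close> cancel.\<close>
  have pair: "(s + (1 + 2 * a)) powr (-1/4) + (s + (1 - 2 * a)) powr (-1/4) \<le>
      p * (2 - 1 / s / 2 + 3 / 8 * (1 + 4 * a\<^sup>2) / s\<^sup>2)" if "64 + a\<^sup>2 \<le> s" for a
  proof -
    \<comment> \<open>As 64 is the square of 8, the shift yields
      \<open>16 * \<bar>a\<bar> \<le> s\<close>, which keeps the relative increments at least
      -1/8.\<close>
    have "0 \<le> (a - 8)\<^sup>2" "0 \<le> (a + 8)\<^sup>2" by auto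
    then have "- s / 8 \<le> 1 + 2 * a" "- s / 8 \<le> 1 - 2 * a"
      using that by (simp_all add: power2_eq_square algebra_simps)
    then have "(s + (1 + 2 * a)) powr (-1/4) + (s + (1 - 2 * a)) powr (-1/4) \<le>
      p * (1 - (1 + 2 * a) / s / 4 + 3 / 16 * ((1 + 2 * a) / s)\<^sup>2) +
      p * (1 - (1 - 2 * a) / s / 4 + 3 / 16 * ((1 - 2 * a) / s)\<^sup>2)"
      unfolding p_def using s by (intro add_mono powr_minus_quarter_le) auto
    also have "\<dots> = p * (2 - 1 / s / 2 + 3 / 8 * (1 + 4 * a\<^sup>2) / s\<^sup>2)"
      using s by (simp add: field_simps power2_eq_square)
    finally show ?thesis .
  qed
  have g: "g (x + 1) y z = (s + (1 + 2 * x)) powr (-1/4)"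
    "g (x - 1) y z = (s + (1 - 2 * x)) powr (-1/4)"
    "g x (y + 1) z = (s + (1 + 2 * y)) powr (-1/4)"
    "g x (y - 1) z = (s + (1 - 2 * y)) powr (-1/4)"
    "g x y (z + 1) = (s + (1 + 2 * z)) powr (-1/4)"
    "g x y (z - 1) = (s + (1 - 2 * z)) powr (-1/4)"
    unfolding g_def s_def
    by (auto intro!: arg_cong[where f = "\<lambda>t. t powr (-1/4)"] simp: power2_eq_square algebra_simps)
  have "g (x + 1) y z + g (x - 1) y z + (g x (y + 1) z + g x (y - 1) z) +
      (g x y (z + 1) + g x y (z - 1)) \<le>
      p * (2 - 1 / s / 2 + 3 / 8 * (1 + 4 * x\<^sup>2) / s\<^sup>2) +
      p * (2 - 1 / s / 2 + 3 / 8 * (1 + 4 * y\<^sup>2) / s\<^sup>2) +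
      p * (2 - 1 / s / 2 + 3 / 8 * (1 + 4 * z\<^sup>2) / s\<^sup>2)"
    unfolding g by (intro add_mono pair) (auto simp: s_def)
  also have "\<dots> = p * (6 - 3 / 2 / s + 3 / 8 * (3 + 4 * (x\<^sup>2 + y\<^sup>2 + z\<^sup>2)) / s\<^sup>2)"
    by (simp add: add_divide_distrib algebra_simps)
  also have "x\<^sup>2 + y\<^sup>2 + z\<^sup>2 = s - 64" by (simp add: s_def)
  \<comment> \<open>With the coefficient 3/16 the terms of order \<open>1 / s\<close> cancel exactly
    in dimension 3. What remains is 9/8 - 96 = -759/8, negative thanks to the shift.\<close>
  also have "6 - 3 / 2 / s + 3 / 8 * (3 + 4 * (s - 64)) / s\<^sup>2 = 6 - 759 / 8 / s\<^sup>2"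
    using s by (simp add: field_simps power2_eq_square)
  also have "p * (6 - 759 / 8 / s\<^sup>2) < p * 6"
    using p s by (intro mult_strict_left_mono) auto
  finally show ?thesis by (simp add: g_def p_def s_def)
qed

section \<open>Nearest neighbours in the integer lattice\<close>

lemma nbrs_zadj:
  assumes x: "x \<in> zlattice d"
  shows "nbrs (zadj d) x = (\<lambda>i. x(i := x i + 1)) ` {..<d} \<union> (\<lambda>i. x(i := x i - 1)) ` {..<d}"
    (is "_ = ?A \<union> ?B")
proof (intro equalityI subsetI)
  fix y assume "y \<in> nbrs (zadj d) x"
  then have y: "y \<in> zlattice d" and s: "(\<Sum>i<d. \<bar>x i - y i\<bar>) = 1"
    by (auto simp: nbrs_def zadj_def)
  obtain i where i: "i < d" "\<bar>x i - y i\<bar> \<noteq> 0"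
  proof (rule ccontr)
    assume "\<not> thesis"
    then have "(\<Sum>i<d. \<bar>x i - y i\<bar>) = 0" using that by (intro sum.neutral) blast
    then show False using s by simp
  qed
  \<comment> \<open>Nonnegative integers with sum 1: the nonzero one is 1 and the others
    vanish.\<close>
  have "(\<Sum>i<d. \<bar>x i - y i\<bar>) = \<bar>x i - y i\<bar> + (\<Sum>j\<in>{..<d} - {i}. \<bar>x j - y j\<bar>)"
    using i by (intro sum.remove) auto
  moreover have "0 \<le> (\<Sum>j\<in>{..<d} - {i}. \<bar>x j - y j\<bar>)" by (intro sum_nonneg) auto
  ultimately have one: "\<bar>x i - y i\<bar> = 1" and "(\<Sum>j\<in>{..<d} - {i}. \<bar>x j - y j\<bar>) = 0"
    using i s by linarith+
  then have "\<forall>j\<in>{..<d} - {i}. \<bar>x j - y j\<bar> = 0"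
    by (subst (asm) sum_nonneg_eq_0_iff) auto
  then have yj: "y j = x j" if "j \<noteq> i" for j
    using x y that by (cases "j < d") (auto simp: zlattice_def)
  then have "y = x(i := y i)" by auto
  moreover have "y i = x i + 1 \<or> y i = x i - 1" using one by linarith
  ultimately have "y = x(i := x i + 1) \<or> y = x(i := x i - 1)" by metis
  then show "y \<in> ?A \<union> ?B" using i(1) by blast
next
  fix y assume "y \<in> ?A \<union> ?B"
  then obtain i where i: "i < d" and y: "y = x(i := x i + 1) \<or> y = x(i := x i - 1)" by auto
  have "(\<Sum>j<d. \<bar>x j - y j\<bar>) = (\<Sum>j<d. if i = j then 1 else 0)"
    using y by (intro sum.cong) auto
  moreover have "y \<in> zlattice d" using x y i by (auto simp: zlattice_def)
  ultimately show "y \<in> nbrs (zadj d) x"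
    using i x by (simp add: nbrs_def zadj_def)
qed

lemma finite_nbrs_zadj: "finite (nbrs (zadj d) x)"
proof (cases "x \<in> zlattice d")
  case True
  then show ?thesis by (simp add: nbrs_zadj)
next
  case False
  then have "nbrs (zadj d) x = {}" by (auto simp: nbrs_def zadj_def)
  then show ?thesis by simp
qed

text \<open>Serves to show that the \<open>2 * d\<close> lattice neighbours are pairwise
  distinct.\<close>

lemma fun_upd_cong_value:
  assumes "f(i := a) = f(j := b)" "a \<noteq> f i" shows "i = j \<and> a = b"
  using fun_cong[OF assms(1), of i] fun_cong[OF assms(1), of j] assms(2)
  by (auto split: if_splits)

lemma sum_nbrs_zadj:
  assumes x: "x \<in> zlattice d"
  shows "(\<Sum>y\<in>nbrs (zadj d) x. f y) = (\<Sum>i<d. f (x(i := x i + 1)) + f (x(i := x i - 1)))"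
proof -
  have "(\<lambda>i. x(i := x i + 1)) ` {..<d} \<inter> (\<lambda>i. x(i := x i - 1)) ` {..<d} = {}"
    by (auto dest: fun_upd_cong_value)
  moreover have "inj_on (\<lambda>i. x(i := x i + 1)) {..<d}" "inj_on (\<lambda>i. x(i := x i - 1)) {..<d}"
    by (auto intro!: inj_onI dest: fun_upd_cong_value)
  ultimately show ?thesis
    by (simp add: nbrs_zadj[OF x] sum.union_disjoint sum.reindex sum.distrib)
qed

lemma deg_zadj: "x \<in> zlattice d \<Longrightarrow> deg (zadj d) x = 2 * d"
  unfolding deg_def card_eq_sum by (subst sum_nbrs_zadj) auto

lemma simple_graph_zadj: "simple_graph (zlattice d) (zadj d)"
  by (auto simp: simple_graph_def zadj_def abs_minus_commute)

text \<open>Steps in coordinates beyond the first three leave \<open>f\<close> unchanged, so strict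
  superharmonicity carries over from dimension 3.\<close>

lemma zlattice_potential:
  assumes d: "3 \<le> d"
  obtains G :: "(nat \<Rightarrow> int) \<Rightarrow> real" where "\<And>x. 0 \<le> G x"
    "\<And>x. x \<in> zlattice d \<Longrightarrow>
       (\<Sum>y\<in>nbrs (zadj d) x. G y) / deg (zadj d) x + of_bool (x = (\<lambda>_. 0)) \<le> G x"
proof -
  define g where "g = (\<lambda>x y z. (64 + x\<^sup>2 + y\<^sup>2 + z\<^sup>2 :: real) powr (-1/4))"
  define f where "f x = g (x 0) (x 1) (x 2)" for x :: "nat \<Rightarrow> int"
  define A where "A x = (\<Sum>y\<in>nbrs (zadj d) x. f y) / deg (zadj d) x" for x
  have less: "A x < f x" if x: "x \<in> zlattice d" for x
  proof -
    let ?t = "\<lambda>i. f (x(i := x i + 1)) + f (x(i := x i - 1))"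
    have "(\<Sum>i<d. ?t i) = (\<Sum>i<3. ?t i) + (\<Sum>i\<in>{3..<d}. ?t i)"
      using d by (simp add: lessThan_atLeast0 sum.atLeastLessThan_concat)
    also have "(\<Sum>i\<in>{3..<d}. ?t i) = (\<Sum>i\<in>{3..<d}. 2 * f x)"
      by (intro sum.cong) (auto simp: f_def)
    also have "\<dots> = (2 * real d - 6) * f x"
      using d by (simp add: of_nat_diff left_diff_distrib right_diff_distrib)
    also have "(\<Sum>i<3. ?t i) < 6 * f x"
    proof -
      have "(\<Sum>i<3. h i) = h 0 + h 1 + h 2" for h :: "nat \<Rightarrow> real"
        by (simp add: eval_nat_numeral)
      then show ?thesis
        using lattice_potential_3[of "x 0" "x 1" "x 2"] by (simp add: f_def g_def)
    qed
    finally have "(\<Sum>i<d. ?t i) < 2 * d * f x"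
      by (simp add: left_diff_distrib del: fun_upd_apply)
    then show ?thesis
      using d by (simp add: A_def sum_nbrs_zadj[OF x] deg_zadj[OF x] pos_divide_less_eq mult.commute del: fun_upd_apply)
  qed
  \<comment> \<open>The deficit of \<open>f\<close> at the origin; dividing by it gives deficit 1
    there, and elsewhere a nonnegative one suffices.\<close>
  define e where "e = f (\<lambda>_. 0) - A (\<lambda>_. 0)"
  have e: "0 < e" using less[of "\<lambda>_. 0"] by (simp add: e_def zlattice_def)
  show thesis
  proof
    show "0 \<le> f x / e" for x using e by (simp add: f_def g_def)
    fix x assume x: "x \<in> zlattice d"
    have "(\<Sum>y\<in>nbrs (zadj d) x. f y / e) / deg (zadj d) x = A x / e"
      by (simp add: A_def sum_divide_distrib mult.commute)
    also have "\<dots> + of_bool (x = (\<lambda>_. 0)) \<le> f x / e"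
    proof -
      have "A x + e * of_bool (x = (\<lambda>_. 0)) \<le> f x"
        using less[OF x] by (auto simp: e_def)
      then have "(A x + e * of_bool (x = (\<lambda>_. 0))) / e \<le> f x / e"
        using e by (intro divide_right_mono) auto
      then show ?thesis using e by (simp add: add_divide_distrib)
    qed
    finally show "(\<Sum>y\<in>nbrs (zadj d) x. f y / e) / deg (zadj d) x + of_bool (x = (\<lambda>_. 0))
      \<le> f x / e" .
  qed
qed

section \<open>Finitely many returns\<close>

text \<open>Both halves of the theorem are instances, with the Green function and the explicit
  lattice function as \<open>G\<close>.\<close>

lemma grw_AE_finite_visits:
  assumes "simple_graph V adj" "locally_finite V adj" "all_degrees_even V adj"
    "\<And>v. v \<in> V \<Longrightarrow> nbrs adj v \<noteq> {}" "v0 \<in> V" "valid_rule adj R" "grw_process M adj R v0 X"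
    "\<And>x. 0 \<le> G x"
    "\<And>x. x \<in> V \<Longrightarrow> (\<Sum>w\<in>nbrs adj x. G w) / deg adj x + of_bool (x = v0) \<le> (G x :: real)"
  shows "AE \<omega> in M. finite {t. X t \<omega> = v0}"
proof -
  interpret prob_space M using assms(7) by (simp add: grw_process_def)
  interpret greedy_process V adj v0 R M X
    by unfold_locales (use assms in auto)
  show ?thesis using assms(8,9) by (rule AE_finite_visits)
qed

lemma nbrs_nonempty_if_connected:
  assumes "infinite V" "connected_graph V adj" "v \<in> V"
  shows "nbrs adj v \<noteq> {}"
proof -
  obtain y where "y \<in> V" "y \<noteq> v"
    using assms(1) by (metis finite.simps finite_subset insert_iff subsetI)
  then have "adj\<^sup>*\<^sup>* v y" "v \<noteq> y" using assms(2,3) by (auto simp: connected_graph_def)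
  then obtain z where "adj v z" by (metis converse_rtranclpE)
  then show ?thesis by (auto simp: nbrs_def)
qed

theorem mainTheorem11:
  shows
  "(\<forall>(V :: 'v set) adj (v0 :: 'v) (R :: 'v list \<Rightarrow> 'v pmf) (M :: 'w measure) X.
      simple_graph V adj \<and> infinite V \<and> connected_graph V adj \<and> locally_finite V adj \<and>
      all_degrees_even V adj \<and> srw_transient V adj \<and> v0 \<in> V \<and>
      valid_rule adj R \<and> grw_process M adj R v0 X
      \<longrightarrow> (AE \<omega> in M. finite {t. X t \<omega> = v0}))
   \<and>
   (\<forall>d \<ge> 3. \<forall>(R :: (nat \<Rightarrow> int) list \<Rightarrow> (nat \<Rightarrow> int) pmf) (M :: 'u measure) X.
      valid_rule (zadj d) R \<and> grw_process M (zadj d) R (\<lambda>_. 0) X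
      \<longrightarrow> (AE \<omega> in M. finite {t. X t \<omega> = (\<lambda>_. 0)}))"
proof (intro conjI allI impI; (elim conjE)?)
  fix V :: "'v set" and adj and v0 and R :: "'v list \<Rightarrow> 'v pmf" and M :: "'w measure" and X
  assume G: "simple_graph V adj" "infinite V" "connected_graph V adj" "locally_finite V adj"
    "all_degrees_even V adj" and trans: "srw_transient V adj" and v0: "v0 \<in> V"
    and rule: "valid_rule adj R" and proc: "grw_process M adj R v0 X"
  note ne = nbrs_nonempty_if_connected[OF G(2,3)]
  have "even_graph V adj" using G ne by unfold_locales
  then have "finite (nbrs adj x)" for x by (rule even_graph.finite_nbrs)
  moreover have "summable (srw_first_return adj v0)" "(\<Sum>n. srw_first_return adj v0 n) < 1"
    using trans v0 by (simp_all add: srw_transient_def)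
  ultimately obtain g :: "'v \<Rightarrow> real" where g: "\<And>x. 0 \<le> g x"
    "\<And>x. (\<Sum>w\<in>nbrs adj x. g w) / deg adj x + of_bool (x = v0) \<le> g x"
    by (rule transient_imp_potential) (rule that)
  show "AE \<omega> in M. finite {t. X t \<omega> = v0}"
    by (rule grw_AE_finite_visits[OF G(1,4,5) ne v0 rule proc g])
next
  fix d :: nat and R :: "(nat \<Rightarrow> int) list \<Rightarrow> (nat \<Rightarrow> int) pmf" and M :: "'u measure" and X
  assume d: "3 \<le> d" and rule: "valid_rule (zadj d) R"
    and proc: "grw_process M (zadj d) R (\<lambda>_. 0) X"
  obtain g :: "(nat \<Rightarrow> int) \<Rightarrow> real" where g: "\<And>x. 0 \<le> g x"
    "\<And>x. x \<in> zlattice d \<Longrightarrow>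
       (\<Sum>y\<in>nbrs (zadj d) x. g y) / deg (zadj d) x + of_bool (x = (\<lambda>_. 0)) \<le> g x"
    using zlattice_potential[OF d] by blast
  show "AE \<omega> in M. finite {t. X t \<omega> = (\<lambda>_. 0)}"
  proof (rule grw_AE_finite_visits[OF simple_graph_zadj _ _ _ _ rule proc g])
    show "locally_finite (zlattice d) (zadj d)"
      by (simp add: locally_finite_def finite_nbrs_zadj)
    show "all_degrees_even (zlattice d) (zadj d)"
      by (simp add: all_degrees_even_def deg_zadj)
    show "nbrs (zadj d) x \<noteq> {}" if "x \<in> zlattice d" for x
      using nbrs_zadj[OF that] d by (auto simp: lessThan_empty_iff)
    show "(\<lambda>_. 0) \<in> zlattice d" by (simp add: zlattice_def)
  qed
qed

end
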